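(* Let $G=(V,E)$ be a finite graph, let $d_v$ denote the degree of $v\in V$, and let $\tilde d_v:=\max\{d_u : \{u,v\}\in E\text{ or }u=v\}$ be the maximal degree in the neighbourhood of $v$. Let $K\in\mathbb{N}$, $K\ge1$, $\lambda\in(0,\infty)^V$ and $p\in[0,1]^V$. Suppose that $p_v\le\frac13K/\tilde d_v$ for all $v\in V$ (the condition being vacuous when $\tilde d_v=0$). Then the equilibrium service rates $s=(s_v)_{v\in V}$ of $\mathsf{MCH}_\Omega(\lambda,p)$ satisfy $$\tfrac13p_v\le s_v\le p_v\qquad\text{for all }v\in V.$$
   Context: Graphs are finite, undirected, without loops or multiple edges, with non-empty vertex set. Write $[K]=\{1,\dots,K\}$ and $[K]_0=\{0,1,\dots,K\}$. State space: $\Omega:=\{\omega\in[K]_0^V : \omega \text{ is proper}\}$, where $\omega=(\omega_v)_{v\in V}$ is proper if $\omega_u\ne\omega_v$ whenever $\{u,v\}\in E$ and $\omega_u+\omega_v>0$. A vertex $v$ is active in $\omega$ if $\omega_v\neq 0$; colour $0$ means inactive. The chain $\mathsf{MCH}_\Omega(\lambda,p)$ (multicoloured hardcore model) is the continuous-time Markov chain on $\Omega$ in which each vertex $v\in V$ is selected for update at rate $\lambda_v$, independently over the vertices. When $v$ is selected, toss a coin $C\sim\mathrm{Bern}(p_v)$ and independently draw a colour $k\sim\mathrm{Unif}([K])$. If $C=1$ and no neighbour of $v$ currently has colour $k$, then set $v$ to colour $k$; otherwise (if $C=0$ or some neighbour has colour $k$), set $v$ to colour $0$. Its equilibrium (invariant)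 distribution is denoted $\pi$. The equilibrium service rates are $s_v:=\sum_{\omega\in\Omega:\,\omega_v\ne0}\pi(\omega)$ for $v\in V$. *)

theory Defs
  imports "HOL-Probability.Probability_Mass_Function"
begin

text \<open>Graphs have as vertex set a type \<open>'v\<close> of class \<open>finite\<close> (hence finite and non-empty); the
  edges are two-element sets of vertices, so there are no loops or multiple edges.\<close>

definition is_graph :: "'v::finite set set \<Rightarrow> bool" where
  "is_graph E \<longleftrightarrow> (\<forall>e\<in>E. card e = 2)"

definition degree :: "'v::finite set set \<Rightarrow> 'v \<Rightarrow> nat" where
  "degree E v = card {u. {u, v} \<in> E}"

definition max_nbhd_degree :: "'v::finite set set \<Rightarrow> 'v \<Rightarrow> nat" where
  "max_nbhd_degree E v = Max {degree E u |u. {u, v} \<in> E \<or> u = v}"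

type_synonym 'v config = "'v \<Rightarrow> nat"

definition proper :: "'v::finite set set \<Rightarrow> 'v config \<Rightarrow> bool" where
  "proper E \<omega> \<longleftrightarrow> (\<forall>u v. {u, v} \<in> E \<and> \<omega> u + \<omega> v > 0 \<longrightarrow> \<omega> u \<noteq> \<omega> v)"

definition state_space :: "'v::finite set set \<Rightarrow> nat \<Rightarrow> 'v config set" where
  "state_space E K = {\<omega>. (\<forall>v. \<omega> v \<in> {0..K}) \<and> proper E \<omega>}"

text \<open>The law of the configuration obtained from \<open>\<sigma>\<close> when the vertex \<open>v\<close> is selected for update.\<close>

definition update :: "'v::finite set set \<Rightarrow> nat \<Rightarrow> ('v \<Rightarrow> real) \<Rightarrow> 'v \<Rightarrow> 'v config \<Rightarrow> 'v config pmf" where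
  "update E K p v \<sigma> =
     bind_pmf (bernoulli_pmf (p v)) (\<lambda>C.
     bind_pmf (pmf_of_set {1..K}) (\<lambda>k.
     return_pmf (if C \<and> (\<forall>u. {u, v} \<in> E \<longrightarrow> \<sigma> u \<noteq> k) then \<sigma>(v := k) else \<sigma>(v := 0))))"

text \<open>The generator: each vertex \<open>v\<close> is, at rate \<open>r v\<close>, resampled according to \<open>update\<close>.
  For \<open>\<eta> \<noteq> \<omega>\<close> this is the jump rate from \<open>\<omega>\<close> to \<open>\<eta>\<close>, and the rows sum to zero.\<close>

definition MCH_generator ::
  "'v::finite set set \<Rightarrow> nat \<Rightarrow> ('v \<Rightarrow> real) \<Rightarrow> ('v \<Rightarrow> real) \<Rightarrow> 'v config \<Rightarrow> 'v config \<Rightarrow> real" where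
  "MCH_generator E K r p \<omega> \<eta> = (\<Sum>v\<in>UNIV. r v * (pmf (update E K p v \<omega>) \<eta> - of_bool (\<eta> = \<omega>)))"

text \<open>Powers and exponential of a matrix indexed by a finite set \<open>S\<close>. If \<open>Q\<close> is the generator of a
  continuous-time Markov chain on \<open>S\<close>, then \<open>transition S Q t x y\<close> is the probability that the
  chain started in \<open>x\<close> is in \<open>y\<close> at time \<open>t\<close>.\<close>

primrec matrix_pow :: "'s set \<Rightarrow> ('s \<Rightarrow> 's \<Rightarrow> real) \<Rightarrow> nat \<Rightarrow> 's \<Rightarrow> 's \<Rightarrow> real" where
  "matrix_pow S Q 0 = (\<lambda>x y. of_bool (x = y))"
| "matrix_pow S Q (Suc n) = (\<lambda>x y. \<Sum>z\<in>S. Q x z * matrix_pow S Q n z y)"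

definition transition :: "'s set \<Rightarrow> ('s \<Rightarrow> 's \<Rightarrow> real) \<Rightarrow> real \<Rightarrow> 's \<Rightarrow> 's \<Rightarrow> real" where
  "transition S Q t x y = (\<Sum>n. t ^ n / fact n * matrix_pow S Q n x y)"

definition invariant_distribution :: "'s set \<Rightarrow> ('s \<Rightarrow> 's \<Rightarrow> real) \<Rightarrow> 's pmf \<Rightarrow> bool" where
  "invariant_distribution S Q \<pi> \<longleftrightarrow>
     set_pmf \<pi> \<subseteq> S \<and>
     (\<forall>t\<ge>0. \<forall>y\<in>S. (\<Sum>x\<in>S. pmf \<pi> x * transition S Q t x y) = pmf \<pi> y)"

definition service_rate :: "'v::finite set set \<Rightarrow> nat \<Rightarrow> 'v config pmf \<Rightarrow> 'v \<Rightarrow> real" where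
  "service_rate E K \<pi> v = (\<Sum>\<omega>\<in>{\<omega> \<in> state_space E K. \<omega> v \<noteq> 0}. pmf \<pi> \<omega>)"

end

theory Submission
  imports Defs
begin

text \<open>Invariance under the semigroup yields \<open>\<pi> Q = 0\<close> by differentiating at time \<open>0\<close>. Testing this
  identity against the indicator of \<open>\<omega> v \<noteq> 0\<close>, to which only the updates of \<open>v\<close> contribute, shows
  that the service rate of \<open>v\<close> is \<open>p v\<close> times the expected proportion of colours not used by the
  neighbours of \<open>v\<close>. This is at most \<open>p v\<close>. As the number of used colours is at most the number of
  active neighbours, it is at least \<open>p v\<close> times \<open>1 - (\<Sum>u. s u) / K\<close>, the sum being over the
  neighbours \<open>u\<close> of \<open>v\<close>; each term is at most \<open>K / (3 d)\<close>, where \<open>d\<close> is the degree of \<open>v\<close>,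
  so in fact \<open>s v\<close> is at least two thirds of \<open>p v\<close>.\<close>

section \<open>Invariant distributions and generators\<close>

lemma matrix_pow_bound:
  assumes "finite S" "x \<in> S" "\<And>x z. x \<in> S \<Longrightarrow> z \<in> S \<Longrightarrow> \<bar>Q x z\<bar> \<le> M"
  shows "\<bar>matrix_pow S Q n x y\<bar> \<le> (real (card S) * M) ^ n"
  using assms(2)
proof (induction n arbitrary: x)
  case (Suc n)
  have M: "0 \<le> M"
    using assms(3)[OF Suc.prems Suc.prems] by linarith
  have "\<bar>matrix_pow S Q (Suc n) x y\<bar> \<le> (\<Sum>z\<in>S. \<bar>Q x z\<bar> * \<bar>matrix_pow S Q n z y\<bar>)"
    by (simp add: sum_abs flip: abs_mult)
  also have "\<dots> \<le> (\<Sum>z\<in>S. M * (real (card S) * M) ^ n)"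
    using Suc M assms(3) by (intro sum_mono mult_mono) auto
  finally show ?case
    by (simp add: mult_ac)
qed simp

lemma summable_matrix_exp:
  assumes "finite S" "x \<in> S"
  shows "summable (\<lambda>n. t ^ n / fact n * matrix_pow S Q n x y)"
proof -
  \<comment> \<open>The sum of all absolute entries bounds each single one, so the terms of the
    series are dominated by those of the real exponential series at
    \<open>\<bar>t\<bar> * (card S * M)\<close>.\<close>
  define M where "M = (\<Sum>x\<in>S. \<Sum>z\<in>S. \<bar>Q x z\<bar>)"
  have M: "\<bar>Q x z\<bar> \<le> M" if "x \<in> S" "z \<in> S" for x z
  proof -
    have "\<bar>Q x z\<bar> \<le> (\<Sum>z\<in>S. \<bar>Q x z\<bar>)"
      using that assms(1) by (intro member_le_sum) auto
    also have "\<dots> \<le> M"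
      unfolding M_def using that assms(1)
      by (intro member_le_sum[where f = "\<lambda>x. \<Sum>z\<in>S. \<bar>Q x z\<bar>"]) (auto intro: sum_nonneg)
    finally show ?thesis .
  qed
  show ?thesis
  proof (rule summable_comparison_test)
    show "summable (\<lambda>n. (\<bar>t\<bar> * (real (card S) * M)) ^ n / fact n)"
      using summable_exp[of "\<bar>t\<bar> * (real (card S) * M)"] by (simp add: field_simps)
    show "\<exists>N. \<forall>n\<ge>N. norm (t ^ n / fact n * matrix_pow S Q n x y)
        \<le> (\<bar>t\<bar> * (real (card S) * M)) ^ n / fact n"
      using matrix_pow_bound[where M = M, OF assms M]
      by (auto simp: abs_mult power_mult_distrib power_abs intro!: divide_right_mono mult_left_mono)
  qed
qed

lemma invariant_distribution_generator:
  assumes "finite S" "invariant_distribution S Q \<pi>" "y \<in> S"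
  shows "(\<Sum>x\<in>S. pmf \<pi> x * Q x y) = 0"
proof -
  define c where "c n = (\<Sum>x\<in>S. pmf \<pi> x * matrix_pow S Q n x y) / fact n" for n
  define F where "F t = (\<Sum>n. c n * t ^ n)" for t :: real
  have sums: "(\<lambda>n. c n * t ^ n) sums (\<Sum>x\<in>S. pmf \<pi> x * transition S Q t x y)" for t
  proof -
    have "(\<lambda>n. \<Sum>x\<in>S. pmf \<pi> x * (t ^ n / fact n * matrix_pow S Q n x y))
        sums (\<Sum>x\<in>S. pmf \<pi> x * transition S Q t x y)"
      unfolding transition_def
      by (intro sums_sum sums_mult summable_sums summable_matrix_exp assms)
    moreover have "(\<Sum>x\<in>S. pmf \<pi> x * (t ^ n / fact n * matrix_pow S Q n x y)) = c n * t ^ n" for n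
      unfolding c_def sum_distrib_right sum_divide_distrib by (intro sum.cong) (simp_all add: field_simps)
    ultimately show ?thesis
      by simp
  qed
  have const: "F t = pmf \<pi> y" if "t \<ge> 0" for t
    using sums_unique[OF sums[of t]] assms(2,3) that
    by (simp add: F_def invariant_distribution_def)
  \<comment> \<open>Summability at \<open>1\<close> already suffices to differentiate termwise at
    \<open>0\<close>, since \<open>0\<close> lies strictly inside that radius.\<close>
  have "(F has_field_derivative (\<Sum>n. diffs c n * 0 ^ n)) (at 0)"
    unfolding F_def by (rule termdiffs_strong[of _ 1]) (use sums_summable[OF sums[of 1]] in auto)
  then have "(F has_field_derivative c 1) (at 0)"
    by (simp add: diffs_def)
  \<comment> \<open>Invariance makes \<open>F\<close> constant only for \<open>t \<ge> 0\<close>, so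
    the two derivatives are compared within the half-line. They agree because \<open>0\<close> is a
    limit point of it.\<close>
  then have "(F has_field_derivative c 1) (at 0 within {0..})"
    by (rule has_field_derivative_at_within)
  moreover have "(F has_field_derivative 0) (at 0 within {0..})"
    by (rule has_field_derivative_transform_within[of "\<lambda>_. pmf \<pi> y" _ _ _ 1]) (auto simp: const)
  moreover have "at (0::real) within {0..} \<noteq> bot"
    by (simp add: at_within_Ici_at_right)
  ultimately have "c 1 = 0"
    by (metis has_field_derivative_unique)
  moreover have "(\<Sum>z\<in>S. Q x z * of_bool (z = y)) = Q x y" for x
    using assms(1,3) by (simp add: of_bool_def if_distrib sum.delta cong: if_cong)
  ultimately show ?thesis
    by (simp add: c_def)
qed

section \<open>The multicoloured hardcore model\<close>

lemma finite_state_space: "finite (state_space E K)"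
proof (rule finite_subset)
  show "state_space E K \<subseteq> (UNIV :: 'a set) \<rightarrow>\<^sub>E {0..K}"
    by (auto simp: state_space_def)
  show "finite ((UNIV :: 'a set) \<rightarrow>\<^sub>E {0..K})"
    by (intro finite_PiE) auto
qed

lemma not_self_adjacent: "is_graph E \<Longrightarrow> {v, v} \<notin> E"
  by (auto simp: is_graph_def)

text \<open>Without loops, recolouring \<open>v\<close> leaves its neighbours unchanged. Colour
  \<open>0\<close> never causes a conflict, as \<open>proper\<close> allows adjacent zeros.\<close>

lemma state_space_upd:
  assumes "is_graph E" "\<sigma> \<in> state_space E K" "k \<le> K"
    and "k = 0 \<or> (\<forall>u. {u, v} \<in> E \<longrightarrow> \<sigma> u \<noteq> k)"
  shows "\<sigma>(v := k) \<in> state_space E K"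
  using assms not_self_adjacent[OF assms(1)]
  by (auto simp: state_space_def proper_def insert_commute)

lemma set_pmf_update_subset:
  assumes "is_graph E" "K \<ge> 1" "\<sigma> \<in> state_space E K"
  shows "set_pmf (update E K p v \<sigma>) \<subseteq> state_space E K"
  using assms by (auto simp: update_def set_pmf_of_set intro!: state_space_upd split: if_splits)

definition free_colours :: "'v::finite set set \<Rightarrow> nat \<Rightarrow> 'v config \<Rightarrow> 'v \<Rightarrow> nat set" where
  "free_colours E K \<sigma> v = {k \<in> {1..K}. \<forall>u. {u, v} \<in> E \<longrightarrow> \<sigma> u \<noteq> k}"

lemma prob_update_active:
  assumes "K \<ge> 1" "p w \<in> {0..1}"
  shows "measure_pmf.prob (update E K p w \<sigma>) {\<eta>. \<eta> v \<noteq> 0} =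
    (if w = v then p v * card (free_colours E K \<sigma> v) / K else of_bool (\<sigma> v \<noteq> 0))"
proof -
  have "measure_pmf.prob (update E K p w \<sigma>) {\<eta>. \<eta> v \<noteq> 0} =
      pmf (map_pmf (\<lambda>\<eta>. \<eta> v \<noteq> 0) (update E K p w \<sigma>)) True"
    by (simp add: pmf_map vimage_def)
  also have "\<dots> = (if w = v then p v * card (free_colours E K \<sigma> v) / K else of_bool (\<sigma> v \<noteq> 0))"
  proof (cases "w = v")
    case True
    \<comment> \<open>Drawn colours are at least \<open>1\<close>, so \<open>v\<close> ends up
      active exactly when the coin succeeds and the colour is free. Independence of the two draws
      gives the product.\<close>
    have "map_pmf (\<lambda>\<eta>. \<eta> v \<noteq> 0) (update E K p w \<sigma>) =
        bind_pmf (bernoulli_pmf (p v)) (\<lambda>C.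
          map_pmf (\<lambda>k. C \<and> k \<in> free_colours E K \<sigma> v) (pmf_of_set {1..K}))"
      unfolding update_def map_bind_pmf map_pmf_def[of _ "pmf_of_set _"] True
      using assms(1)
      by (intro bind_pmf_cong refl) (auto simp: free_colours_def set_pmf_of_set)
    moreover have "(\<lambda>k. k \<in> free_colours E K \<sigma> v) -` {True} = free_colours E K \<sigma> v"
      by auto
    moreover have "{1..K} \<inter> free_colours E K \<sigma> v = free_colours E K \<sigma> v"
      by (auto simp: free_colours_def)
    ultimately show ?thesis
      using assms True by (simp add: pmf_bind pmf_map measure_pmf_of_set)
  next
    case False
    have "map_pmf (\<lambda>\<eta>. \<eta> v \<noteq> 0) (update E K p w \<sigma>) = return_pmf (\<sigma> v \<noteq> 0)"
      using False unfolding update_def map_bind_pmf by (simp add: if_distrib cong: if_cong)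
    then show ?thesis
      using False by simp
  qed
  finally show ?thesis .
qed

lemma service_rate_eq:
  assumes "is_graph E" "K \<ge> 1" "\<And>v. r v > 0" "\<And>v. p v \<in> {0..1}"
    and "invariant_distribution (state_space E K) (MCH_generator E K r p) \<pi>"
  shows "service_rate E K \<pi> v =
    p v * (\<Sum>\<omega>\<in>state_space E K. pmf \<pi> \<omega> * card (free_colours E K \<omega> v)) / K"
proof -
  define S where "S = state_space E K"
  define f :: "'a config \<Rightarrow> real" where "f \<omega> = of_bool (\<omega> v \<noteq> 0)" for \<omega>
  define a where "a \<omega> = p v * card (free_colours E K \<omega> v) / K" for \<omega>
  have fin: "finite S"
    by (simp add: S_def finite_state_space)
  have upd: "(\<Sum>\<eta>\<in>S. pmf (update E K p w \<omega>) \<eta> * f \<eta>) = (if w = v then a \<omega> else f \<omega>)"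
    if "\<omega> \<in> S" for w \<omega>
  proof -
    \<comment> \<open>As updates stay in \<open>S\<close>, the finite sum over \<open>S\<close> is
      the full expectation of the indicator \<open>f\<close>.\<close>
    have sub: "set_pmf (update E K p w \<omega>) \<subseteq> S"
      using set_pmf_update_subset[OF assms(1,2)] that by (simp add: S_def)
    have "(\<Sum>\<eta>\<in>S. pmf (update E K p w \<omega>) \<eta> * f \<eta>) =
        measure_pmf.expectation (update E K p w \<omega>) (indicator {\<eta>. \<eta> v \<noteq> 0})"
      using sub fin by (subst integral_measure_pmf[of S])
        (auto simp: f_def indicator_def intro!: sum.cong)
    then show ?thesis
      using prob_update_active[of K p w E \<omega> v] assms by (simp add: a_def f_def)
  qed
  \<comment> \<open>For \<open>w \<noteq> v\<close> the expected value of \<open>f\<close> after the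
    update is \<open>f \<omega>\<close> itself, so that summand cancels.\<close>
  have row: "(\<Sum>\<eta>\<in>S. MCH_generator E K r p \<omega> \<eta> * f \<eta>) = r v * (a \<omega> - f \<omega>)" if "\<omega> \<in> S" for \<omega>
  proof -
    have "(\<Sum>\<eta>\<in>S. MCH_generator E K r p \<omega> \<eta> * f \<eta>) =
        (\<Sum>w\<in>UNIV. r w * ((\<Sum>\<eta>\<in>S. pmf (update E K p w \<omega>) \<eta> * f \<eta>) -
          (\<Sum>\<eta>\<in>S. of_bool (\<eta> = \<omega>) * f \<eta>)))"
      unfolding MCH_generator_def sum_distrib_right
      by (subst sum.swap) (simp add: algebra_simps sum_subtractf sum_distrib_left)
    also have "(\<Sum>\<eta>\<in>S. of_bool (\<eta> = \<omega>) * f \<eta>) = f \<omega>"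
      using that fin by simp
    also have "(\<Sum>w\<in>UNIV. r w * ((\<Sum>\<eta>\<in>S. pmf (update E K p w \<omega>) \<eta> * f \<eta>) - f \<omega>)) =
        (\<Sum>w\<in>UNIV. if w = v then r v * (a \<omega> - f \<omega>) else 0)"
      using that by (intro sum.cong) (auto simp: upd)
    finally show ?thesis
      by simp
  qed
  have "0 = (\<Sum>\<eta>\<in>S. (\<Sum>\<omega>\<in>S. pmf \<pi> \<omega> * MCH_generator E K r p \<omega> \<eta>) * f \<eta>)"
    using invariant_distribution_generator[OF fin] assms(5) by (simp add: S_def)
  also have "\<dots> = (\<Sum>\<omega>\<in>S. pmf \<pi> \<omega> * (\<Sum>\<eta>\<in>S. MCH_generator E K r p \<omega> \<eta> * f \<eta>))"
    unfolding sum_distrib_right sum_distrib_left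
    by (subst sum.swap) (simp add: mult_ac)
  also have "\<dots> = (\<Sum>\<omega>\<in>S. pmf \<pi> \<omega> * (r v * (a \<omega> - f \<omega>)))"
    by (simp add: row)
  also have "\<dots> = r v * ((\<Sum>\<omega>\<in>S. pmf \<pi> \<omega> * a \<omega>) - (\<Sum>\<omega>\<in>S. pmf \<pi> \<omega> * f \<omega>))"
    by (simp add: algebra_simps sum_subtractf sum_distrib_left)
  \<comment> \<open>Positivity of \<open>r v\<close> allows the rate to be cancelled.\<close>
  finally have "(\<Sum>\<omega>\<in>S. pmf \<pi> \<omega> * f \<omega>) = (\<Sum>\<omega>\<in>S. pmf \<pi> \<omega> * a \<omega>)"
    using assms(3)[of v] by simp
  moreover have "(\<Sum>\<omega>\<in>S. pmf \<pi> \<omega> * f \<omega>) = service_rate E K \<pi> v"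
    using fin unfolding service_rate_def S_def[symmetric]
    by (auto simp: f_def intro!: sum.mono_neutral_cong_right)
  ultimately show ?thesis
    by (simp add: a_def S_def sum_distrib_left sum_divide_distrib mult_ac)
qed

text \<open>Every blocked colour is worn by some active neighbour. Neighbours may share a colour,
  hence only an inequality.\<close>

lemma card_free_colours_ge:
  "real K - (\<Sum>u | {u, v} \<in> E. of_bool (\<omega> u \<noteq> 0)) \<le> card (free_colours E K \<omega> v)"
proof -
  let ?A = "{u. {u, v} \<in> E \<and> \<omega> u \<noteq> 0}"
  have "{1..K} \<subseteq> free_colours E K \<omega> v \<union> \<omega> ` ?A"
    by (force simp: free_colours_def)
  then have "card {1..K} \<le> card (free_colours E K \<omega> v \<union> \<omega> ` ?A)"
    by (intro card_mono) (auto simp: free_colours_def)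
  also have "\<dots> \<le> card (free_colours E K \<omega> v) + card ?A"
    by (meson add_left_mono card_Un_le card_image_le finite le_trans)
  finally have "real K \<le> card (free_colours E K \<omega> v) + real (card ?A)"
    by simp
  moreover have "(\<Sum>u | {u, v} \<in> E. of_bool (\<omega> u \<noteq> 0)) = real (card ?A)"
    by (simp add: of_bool_def sum.If_cases Collect_conj_eq)
  ultimately show ?thesis
    by simp
qed

lemma degree_le_max_nbhd_degree:
  "{u, v} \<in> E \<Longrightarrow> degree E v \<le> max_nbhd_degree E u"
  unfolding max_nbhd_degree_def by (rule Max_ge) (auto simp: insert_commute)

theorem proposition1:
  fixes E :: "'v::finite set set"
    and K :: nat
    and r p :: "'v \<Rightarrow> real"
    and \<pi> :: "'v config pmf"
  assumes "is_graph E"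
    and "K \<ge> 1"
    and "\<And>v. r v > 0"
    and "\<And>v. p v \<in> {0..1}"
    and "\<And>v. max_nbhd_degree E v \<noteq> 0 \<Longrightarrow> p v \<le> 1 / 3 * real K / real (max_nbhd_degree E v)"
    and "invariant_distribution (state_space E K) (MCH_generator E K r p) \<pi>"
  shows "\<forall>v. 1 / 3 * p v \<le> service_rate E K \<pi> v \<and> service_rate E K \<pi> v \<le> p v"
proof -
  define S where "S = state_space E K"
  define A where "A v = (\<Sum>\<omega>\<in>S. pmf \<pi> \<omega> * card (free_colours E K \<omega> v))" for v
  have fin: "finite S"
    by (simp add: S_def finite_state_space)
  have K: "real K > 0"
    using assms(2) by simp
  have mass: "(\<Sum>\<omega>\<in>S. pmf \<pi> \<omega>) = 1"
    using assms(6) fin by (intro sum_pmf_eq_1) (auto simp: S_def invariant_distribution_def)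
  have s_eq: "service_rate E K \<pi> v = p v * (A v / K)" for v
    using service_rate_eq[of E K r p \<pi> v] assms by (simp add: A_def S_def)
  have p: "0 \<le> p v" for v
    using assms(4)[of v] by simp
  have upper: "service_rate E K \<pi> v \<le> p v" for v
  proof -
    have "card (free_colours E K \<omega> v) \<le> card {1..K}" for \<omega>
      by (intro card_mono) (auto simp: free_colours_def)
    then have "A v \<le> (\<Sum>\<omega>\<in>S. pmf \<pi> \<omega> * K)"
      unfolding A_def by (intro sum_mono mult_left_mono) auto
    also have "\<dots> = K"
      by (simp add: mass flip: sum_distrib_right)
    finally have "A v / K \<le> 1"
      using K by simp
    then show ?thesis
      unfolding s_eq using p by (rule mult_left_le)
  qed
  have "1 / 3 * p v \<le> service_rate E K \<pi> v" for v
  proof -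
    \<comment> \<open>The bound on \<open>p\<close> is used at the neighbour \<open>u\<close>: its
      \<open>max_nbhd_degree\<close> also takes the degree of \<open>v\<close> into account, so the
      bound can be stated in terms of that degree.\<close>
    have nbr: "service_rate E K \<pi> u \<le> K / (3 * degree E v)" if "{u, v} \<in> E" for u
    proof -
      have pos: "degree E v > 0"
        using that by (auto simp: degree_def card_gt_0_iff)
      moreover have le: "degree E v \<le> max_nbhd_degree E u"
        using that by (rule degree_le_max_nbhd_degree)
      ultimately have "p u \<le> K / (3 * max_nbhd_degree E u)"
        using assms(5)[of u] by simp
      also have "\<dots> \<le> K / (3 * degree E v)"
        using pos le by (intro divide_left_mono) auto
      finally show ?thesis
        using upper[of u] by linarith
    qed
    have act: "(\<Sum>\<omega>\<in>S. pmf \<pi> \<omega> * of_bool (\<omega> u \<noteq> 0)) = service_rate E K \<pi> u" for u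
      using fin unfolding service_rate_def S_def[symmetric]
      by (auto intro!: sum.mono_neutral_cong_right)
    have "(\<Sum>u | {u, v} \<in> E. service_rate E K \<pi> u) \<le> (\<Sum>u | {u, v} \<in> E. K / (3 * degree E v))"
      by (intro sum_mono nbr) auto
    \<comment> \<open>Equality holds unless \<open>v\<close> is isolated, in which case the sum is
      empty.\<close>
    also have "\<dots> \<le> K / 3"
      by (auto simp: degree_def)
    finally have sum_le: "(\<Sum>u | {u, v} \<in> E. service_rate E K \<pi> u) \<le> K / 3" .
    \<comment> \<open>By linearity, the expected number of active neighbours is the sum of their
      service rates, whatever their correlations. The constant \<open>K\<close> enters the average
      because \<pi> has mass one on \<open>S\<close>.\<close>
    have "K - (\<Sum>u | {u, v} \<in> E. service_rate E K \<pi> u) =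
        (\<Sum>\<omega>\<in>S. pmf \<pi> \<omega> * (real K - (\<Sum>u | {u, v} \<in> E. of_bool (\<omega> u \<noteq> 0))))"
      unfolding act[symmetric] right_diff_distrib sum_subtractf sum_distrib_left
      by (subst sum.swap) (simp add: mass flip: sum_distrib_right)
    also have "\<dots> \<le> A v"
      unfolding A_def by (intro sum_mono mult_left_mono card_free_colours_ge) auto
    finally have "K / 3 \<le> A v"
      using sum_le K by linarith
    then have "1 / 3 \<le> A v / K"
      using K by (simp add: field_simps)
    then show ?thesis
      unfolding s_eq using mult_left_mono[OF _ p] by (metis mult.commute)
  qed
  with upper show ?thesis
    by blast
qed

end
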